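(* Let $X,Y,V,W$, the forms $\mathsf a,\mathsf c,\mathsf n,\mathsf m$, the subspaces $X_h,Y_h,V_h,W_h$ of common dimension $N$, the discrete inf-sup constants $\gamma_{\mathsf A},\gamma_{\mathsf C},\gamma_{\mathsf N},\gamma_{\mathsf M}>0$, the discrete operators and the Galerkin matrices be as in the context, and put $\mathsf P_h:=\mathsf M_h^{-1}\mathsf C_h\mathsf N_h^{-1}$ and $\mathbf P:=\mathbf M^{-1}\mathbf C\mathbf N^{-1}$. Then the spectral condition number satisfies $$\kappa_S(\mathbf P\mathbf A)\le \kappa(\mathsf P_h\mathsf A_h)\le \frac{\|\mathsf m\|\|\mathsf n\|\|\mathsf c\|\|\mathsf a\|}{\gamma_{\mathsf M}\gamma_{\mathsf N}\gamma_{\mathsf C}\gamma_{\mathsf A}}=:K_\star ,$$ and the Euclidean condition number satisfies $$\kappa_2(\mathbf P\mathbf A)\le K_\star\left(\frac{\|\Lambda_h\|}{\gamma_{\Lambda_h}}\right)^2=K_\star K_{\Lambda_h}^2 .$$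
   Context: Setting. $X,Y,V,W$ are complex reflexive Banach spaces. $\mathsf a$ on $X\times Y$, $\mathsf c$ on $V\times W$, $\mathsf n$ on $V\times Y$ and $\mathsf m$ on $X\times W$ are bounded sesquilinear forms (linear in the first, antilinear in the second argument), with norms $\|\mathsf a\|=\sup_{x\ne0,y\ne0}|\mathsf a(x,y)|/(\|x\|_X\|y\|_Y)$, and similarly $\|\mathsf c\|,\|\mathsf n\|,\|\mathsf m\|$. A prime denotes the space of bounded antilinear functionals. It is assumed that for every $b\in Y'$ there is a unique $u\in X$ with $\mathsf a(u,v)=b(v)$ for all $v\in Y$. For a fixed index $h>0$, $X_h\subset X$, $Y_h\subset Y$, $V_h\subset V$, $W_h\subset W$ are subspaces of the same finite dimension $N$. Discrete inf-sup conditions: there is $\gamma_{\mathsf A}>0$ with $\sup_{v_h\in Y_h\setminus\{0\}}|\mathsf a(u_h,v_h)|/\|v_h\|_Y\ge\gamma_{\mathsf A}\|u_h\|_X$ for all $u_h\in X_h$; likewise $\mathsf c$ on $V_h\times W_h$, $\mathsf n$ on $V_h\times Y_h$, $\mathsf m$ on $X_h\times W_h$ satisfy the analogous condition (supremum over the second argument) with constants $\gamma_{\mathsf C},\gamma_{\mathsf N},\gamma_{\mathsf M}>0$. Discrete operators: $\mathsf A_h:X_h\to Y_h'$, $\langle\mathsf A_hu_h,v_h\rangle=\mathsf a(u_h,v_h)$; analogously $\mathsf C_h:V_h\to W_h'$, $\mathsf N_h:V_h\to Y_h'$, $\mathsf M_h:X_h\to W_h'$. Thus $\mathsf P_h\mathsf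 A_h:X_h\to X_h$. Matrices: given bases $\{\varphi_i\}$ of $X_h$, $\{\phi_i\}$ of $Y_h$, $\{\psi_i\}$ of $V_h$, $\{\xi_i\}$ of $W_h$, $\mathbf A=(\mathsf a(\varphi_j,\phi_i))_{i,j}$, $\mathbf C=(\mathsf c(\psi_j,\xi_i))_{i,j}$, $\mathbf N=(\mathsf n(\psi_j,\phi_i))_{i,j}$, $\mathbf M=(\mathsf m(\varphi_j,\xi_i))_{i,j}$, $1\le i,j\le N$. Condition numbers: $\kappa(\mathsf P_h\mathsf A_h)=\|\mathsf P_h\mathsf A_h\|_{X_h\to X_h}\|(\mathsf P_h\mathsf A_h)^{-1}\|_{X_h\to X_h}$ (operator norms with respect to $\|\cdot\|_X$); for an invertible matrix $\mathbf Q$, $\kappa_S(\mathbf Q)=\varrho(\mathbf Q)\varrho(\mathbf Q^{-1})$ with $\varrho$ the spectral radius, and $\kappa_2(\mathbf Q)=\|\mathbf Q\|_2\|\mathbf Q^{-1}\|_2$ with $\|\cdot\|_2$ the matrix norm induced by the Euclidean norm. Synthesis operator: $\Lambda_h:\mathbb C^N\to X_h$, $\mathbf u=(u_i)\mapsto u_h=\sum_iu_i\varphi_i$; $\gamma_{\Lambda_h}=\inf_{u_h\in X_h\setminus\{0\}}\|u_h\|_X/\|\mathbf u\|_2$, $\|\Lambda_h\|=\sup_{u_h\in X_h\setminus\{0\}}\|u_h\|_X/\|\mathbf u\|_2$, $K_{\Lambda_h}=\|\Lambda_h\|/\gamma_{\Lambda_h}$. *)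

theory Defs
  imports "HOL-Analysis.Analysis"
begin

class complex_normed_vector = real_normed_vector +
  fixes scaleC :: "complex \<Rightarrow> 'a \<Rightarrow> 'a"  (infixr "*\<^sub>C" 75)
  assumes scaleC_add_right: "c *\<^sub>C (x + y) = c *\<^sub>C x + c *\<^sub>C y"
    and scaleC_add_left: "(c + d) *\<^sub>C x = c *\<^sub>C x + d *\<^sub>C x"
    and scaleC_scaleC: "c *\<^sub>C d *\<^sub>C x = (c * d) *\<^sub>C x"
    and scaleC_one: "1 *\<^sub>C x = x"
    and scaleR_scaleC: "r *\<^sub>R x = complex_of_real r *\<^sub>C x"
    and norm_scaleC: "norm (c *\<^sub>C x) = cmod c * norm x"

class complex_banach = complex_normed_vector + complete_space

global_interpretation complex_vector: vector_space
  "scaleC :: complex \<Rightarrow> 'a \<Rightarrow> 'a :: complex_normed_vector"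
  by unfold_locales
    (simp_all add: scaleC_add_right scaleC_add_left scaleC_scaleC scaleC_one)

text \<open>
  The space of bounded antilinear functionals on a subspace \<open>S\<close>.  Functionals are
  fixed to be undefined outside \<open>S\<close>, so that equality in \<open>antidual S\<close> is equality
  on \<open>S\<close>; for \<open>S = UNIV\<close> this is no restriction.
\<close>

definition antidual :: "'a :: complex_normed_vector set \<Rightarrow> ('a \<Rightarrow> complex) set" where
  "antidual S = {f \<in> extensional S.
     (\<forall>x\<in>S. \<forall>y\<in>S. f (x + y) = f x + f y) \<and>
     (\<forall>c. \<forall>x\<in>S. f (c *\<^sub>C x) = cnj c * f x) \<and>
     (\<exists>K. \<forall>x\<in>S. cmod (f x) \<le> K * norm x)}"

text \<open>
  Every bounded antilinear functional \<open>F\<close> on the antidual (normed by \<open>onorm\<close>) is the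
  evaluation at a point.  Since the functionals are antilinear, the canonical linear
  embedding into the bidual sends \<open>x\<close> to the conjugate of \<open>f x\<close>.
\<close>

definition reflexive_space :: "'a :: complex_normed_vector itself \<Rightarrow> bool" where
  "reflexive_space T \<longleftrightarrow>
     (\<forall>F :: ('a \<Rightarrow> complex) \<Rightarrow> complex.
        (\<forall>f\<in>antidual UNIV. \<forall>g\<in>antidual UNIV. F (\<lambda>x. f x + g x) = F f + F g) \<and>
        (\<forall>c. \<forall>f\<in>antidual UNIV. F (\<lambda>x. c * f x) = cnj c * F f) \<and>
        (\<exists>K. \<forall>f\<in>antidual UNIV. cmod (F f) \<le> K * onorm f)
        \<longrightarrow> (\<exists>x. \<forall>f\<in>antidual UNIV. F f = cnj (f x)))"

text \<open>\<open>bounded_bilinear\<close> is over the reals; complex homogeneity is added to it.\<close>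

definition bounded_sesquilinear ::
  "('a :: complex_normed_vector \<Rightarrow> 'b :: complex_normed_vector \<Rightarrow> complex) \<Rightarrow> bool" where
  "bounded_sesquilinear s \<longleftrightarrow> bounded_bilinear s \<and>
     (\<forall>c x y. s (c *\<^sub>C x) y = c * s x y) \<and>
     (\<forall>c x y. s x (c *\<^sub>C y) = cnj c * s x y)"

definition form_norm ::
  "('a :: complex_normed_vector \<Rightarrow> 'b :: complex_normed_vector \<Rightarrow> complex) \<Rightarrow> real" where
  "form_norm s = (SUP (x, y)\<in>(UNIV - {0}) \<times> (UNIV - {0}). cmod (s x y) / (norm x * norm y))"

definition discrete_inf_sup ::
  "('a :: complex_normed_vector \<Rightarrow> 'b :: complex_normed_vector \<Rightarrow> complex)
     \<Rightarrow> 'a set \<Rightarrow> 'b set \<Rightarrow> real \<Rightarrow> bool" where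
  "discrete_inf_sup s U Z \<gamma> \<longleftrightarrow>
     (\<forall>u\<in>U. (SUP v\<in>Z - {0}. cmod (s u v) / norm v) \<ge> \<gamma> * norm u)"

text \<open>As a map from \<open>U\<close> into \<open>antidual Z\<close>; only its values on \<open>U\<close> are meaningful.\<close>

definition discrete_op ::
  "('a \<Rightarrow> 'b \<Rightarrow> complex) \<Rightarrow> 'a set \<Rightarrow> 'b set \<Rightarrow> 'a \<Rightarrow> 'b \<Rightarrow> complex" where
  "discrete_op s U Z = (\<lambda>u\<in>U. \<lambda>v\<in>Z. s u v)"

definition op_norm_on ::
  "'a :: complex_normed_vector set \<Rightarrow> ('a \<Rightarrow> 'b :: complex_normed_vector) \<Rightarrow> real" where
  "op_norm_on U T = (SUP u\<in>U - {0}. norm (T u) / norm u)"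

definition cond_op :: "'a :: complex_normed_vector set \<Rightarrow> ('a \<Rightarrow> 'a) \<Rightarrow> real" where
  "cond_op U T = op_norm_on U T * op_norm_on U (inv_into U T)"

definition is_basis :: "('n :: finite \<Rightarrow> 'a :: complex_normed_vector) \<Rightarrow> 'a set \<Rightarrow> bool" where
  "is_basis b U \<longleftrightarrow> inj b \<and> \<not> complex_vector.dependent (range b) \<and>
     complex_vector.span (range b) = U"

definition galerkin_matrix ::
  "('a \<Rightarrow> 'b \<Rightarrow> complex) \<Rightarrow> ('n :: finite \<Rightarrow> 'a) \<Rightarrow> ('n \<Rightarrow> 'b) \<Rightarrow> complex ^ 'n ^ 'n" where
  "galerkin_matrix s b t = (\<chi> i j. s (b j) (t i))"

definition spectral_radius :: "complex ^ 'n ^ 'n \<Rightarrow> real" where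
  "spectral_radius Q = (SUP \<mu>\<in>{\<mu>. \<exists>v. v \<noteq> 0 \<and> Q *v v = \<mu> *s v}. cmod \<mu>)"

definition cond_spectral :: "complex ^ 'n ^ 'n \<Rightarrow> real" where
  "cond_spectral Q = spectral_radius Q * spectral_radius (matrix_inv Q)"

definition cond_2 :: "complex ^ 'n ^ 'n \<Rightarrow> real" where
  "cond_2 Q = onorm ((*v) Q) * onorm ((*v) (matrix_inv Q))"

definition synthesis ::
  "('n :: finite \<Rightarrow> 'a :: complex_normed_vector) \<Rightarrow> complex ^ 'n \<Rightarrow> 'a" where
  "synthesis b u = (\<Sum>i\<in>UNIV. (u $ i) *\<^sub>C b i)"

text \<open>
  Infimum and supremum over the nonzero elements of \<open>U\<close>, each written as
  \<open>synthesis b u\<close> with its coefficient vector \<open>u\<close>.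
\<close>

definition synthesis_lower ::
  "('n :: finite \<Rightarrow> 'a :: complex_normed_vector) \<Rightarrow> 'a set \<Rightarrow> real" where
  "synthesis_lower b U =
     (INF u\<in>{u. synthesis b u \<in> U - {0}}. norm (synthesis b u) / norm u)"

definition synthesis_norm ::
  "('n :: finite \<Rightarrow> 'a :: complex_normed_vector) \<Rightarrow> 'a set \<Rightarrow> real" where
  "synthesis_norm b U =
     (SUP u\<in>{u. synthesis b u \<in> U - {0}}. norm (synthesis b u) / norm u)"

end

theory Submission
  imports Defs "HOL-Computational_Algebra.Fundamental_Theorem_Algebra"
begin

text \<open>
  If \<open>s x y = t x' y\<close> for all discrete \<open>y\<close>, the inf-sup condition of \<open>t\<close> gives
  \<open>\<gamma>\<^sub>t \<parallel>x'\<parallel> \<le> \<parallel>s\<parallel> \<parallel>x\<parallel>\<close>, and the one of \<open>s\<close> gives the reverse estimate. Applied to the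
  two factors \<open>N\<^sub>h\<inverse> A\<^sub>h\<close> and \<open>M\<^sub>h\<inverse> C\<^sub>h\<close>, this bounds \<open>P\<^sub>h A\<^sub>h\<close> and its inverse without passing
  through dual norms. The synthesis operator conjugates \<open>P\<^sub>h A\<^sub>h\<close> to the matrix \<open>P A\<close>: an eigenvector
  of \<open>P A\<close> thus yields an eigenvector of \<open>P\<^sub>h A\<^sub>h\<close>, which bounds the spectral radii, and comparing
  the two norms on coefficient vectors costs one factor \<open>K\<^sub>\<Lambda>\<close> for each of \<open>P A\<close> and its inverse.
\<close>

section \<open>Eigenvalues of complex matrices\<close>

text \<open>This is the vector \<open>p(Q) v\<close>, built from the Krylov sequence
  \<open>v\<close>, \<open>Q v\<close>, \<open>Q (Q v)\<close> and so on. Only iterates of one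
  vector enter, so no powers of matrices have to be formed.\<close>

definition poly_matrix_apply :: "complex poly \<Rightarrow> complex ^ 'n ^ 'n \<Rightarrow> complex ^ 'n \<Rightarrow> complex ^ 'n" where
  "poly_matrix_apply p Q v = (\<Sum>i\<le>degree p. coeff p i *s (((*v) Q ^^ i) v))"

lemma poly_matrix_apply_altdef:
  assumes "degree p \<le> k"
  shows "poly_matrix_apply p Q v = (\<Sum>i\<le>k. coeff p i *s (((*v) Q ^^ i) v))"
  unfolding poly_matrix_apply_def
  by (rule sum.mono_neutral_left) (use assms in \<open>auto simp: coeff_eq_0\<close>)

lemma matrix_pow_vector_diff:
  fixes Q :: "complex ^ 'n ^ 'n"
  shows "((*v) Q ^^ i) (Q *v v - \<mu> *s v) = ((*v) Q ^^ Suc i) v - \<mu> *s (((*v) Q ^^ i) v)"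
proof (induction i)
  case (Suc i)
  then show ?case
    by (simp add: matrix_vector_mult_diff_distrib vector_scalar_commute)
qed simp

text \<open>A linear factor of the polynomial can be moved onto the vector because the iterates of
  \<open>Q\<close> commute with \<open>Q - \<mu>\<close>. This makes an induction on the degree
  possible.\<close>

lemma poly_matrix_apply_linear_factor:
  fixes Q :: "complex ^ 'n ^ 'n"
  shows "poly_matrix_apply ([:- \<mu>, 1:] * q) Q v = poly_matrix_apply q Q (Q *v v - \<mu> *s v)"
proof -
  define k where "k = degree q"
  define f where "f i = ((*v) Q ^^ i) v" for i
  have deg: "degree ([:- \<mu>, 1:] * q) \<le> Suc k"
    using degree_mult_le[of "[:- \<mu>, 1:]" q] by (simp add: k_def)
  \<comment> \<open>The factor \<open>x\<close> shifts the coefficients by one, so the first sum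
    below is reindexed; in the second the top summand vanishes, since \<open>Suc k\<close> exceeds
    the degree of \<open>q\<close>.\<close>
  have co: "coeff ([:- \<mu>, 1:] * q) i = (case i of 0 \<Rightarrow> 0 | Suc j \<Rightarrow> coeff q j) - \<mu> * coeff q i" for i
    by (simp add: coeff_pCons split: nat.split)
  have "poly_matrix_apply ([:- \<mu>, 1:] * q) Q v
      = (\<Sum>i\<le>Suc k. (case i of 0 \<Rightarrow> 0 | Suc j \<Rightarrow> coeff q j) *s f i) - (\<Sum>i\<le>Suc k. (\<mu> * coeff q i) *s f i)"
    unfolding poly_matrix_apply_altdef[OF deg] co
    by (simp only: f_def vector_sub_rdistrib sum_subtractf)
  also have "(\<Sum>i\<le>Suc k. (case i of 0 \<Rightarrow> 0 | Suc j \<Rightarrow> coeff q j) *s f i) = (\<Sum>i\<le>k. coeff q i *s f (Suc i))"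
    by (subst sum.atMost_Suc_shift) simp
  also have "(\<Sum>i\<le>Suc k. (\<mu> * coeff q i) *s f i) = (\<Sum>i\<le>k. coeff q i *s (\<mu> *s f i))"
    by (simp add: coeff_eq_0 k_def vector_smult_assoc mult.commute)
  also have "(\<Sum>i\<le>k. coeff q i *s f (Suc i)) - (\<Sum>i\<le>k. coeff q i *s (\<mu> *s f i))
      = (\<Sum>i\<le>k. coeff q i *s (f (Suc i) - \<mu> *s f i))"
    by (simp only: vector_ssub_ldistrib sum_subtractf)
  also have "\<dots> = poly_matrix_apply q Q (Q *v v - \<mu> *s v)"
    by (simp only: poly_matrix_apply_def f_def k_def matrix_pow_vector_diff)
  finally show ?thesis .
qed

text \<open>Roots are peeled off one at a time: for a root \<open>\<mu>\<close> of \<open>p\<close>,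
  either \<open>v\<close> is already an eigenvector, or \<open>(Q - \<mu>) v\<close> is nonzero and
  is annihilated by the cofactor of smaller degree.\<close>

lemma eigenvalue_if_annihilated:
  fixes Q :: "complex ^ 'n ^ 'n"
  assumes "p \<noteq> 0" "v \<noteq> 0" "poly_matrix_apply p Q v = 0"
  shows "\<exists>\<mu> w. w \<noteq> 0 \<and> Q *v w = \<mu> *s w"
  using assms
proof (induction "degree p" arbitrary: p v)
  case 0
  \<comment> \<open>A nonzero constant cannot annihilate a nonzero vector, so this case is
    contradictory.\<close>
  then obtain c where "p = [:c:]" by (metis degree_eq_zeroE)
  with 0 show ?case by (simp add: poly_matrix_apply_def)
next
  case (Suc k)
  then have "\<not> constant (poly p)" by (simp add: constant_degree)
  then obtain \<mu> where "poly p \<mu> = 0" using fundamental_theorem_of_algebra by blast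
  then obtain q where q: "p = [:- \<mu>, 1:] * q" by (metis dvdE poly_eq_0_iff_dvd)
  with Suc.prems have "q \<noteq> 0" by auto
  then have "k = degree q" using Suc.hyps(2) degree_mult_eq[of "[:- \<mu>, 1:]" q] unfolding q by simp
  show ?case
  proof (cases "Q *v v = \<mu> *s v")
    case True
    with Suc.prems show ?thesis by blast
  next
    case False
    with Suc.hyps(1)[of q "Q *v v - \<mu> *s v"] \<open>k = degree q\<close> \<open>q \<noteq> 0\<close> Suc.prems(3) q
    show ?thesis by (metis poly_matrix_apply_linear_factor eq_iff_diff_eq_0)
  qed
qed

text \<open>The \<open>CARD('n) + 1\<close> vectors \<open>v, Q v, ...\<close> live in a space of
  dimension \<open>CARD('n)\<close>; the coefficients of a linear relation between them are those of
  the polynomial.\<close>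

lemma annihilating_poly_exists:
  fixes Q :: "complex ^ 'n ^ 'n"
  shows "\<exists>p. p \<noteq> 0 \<and> poly_matrix_apply p Q v = 0"
proof -
  define f where "f i = ((*v) Q ^^ i) v" for i
  have "\<exists>c. (\<exists>i\<le>CARD('n). c i \<noteq> 0) \<and> (\<Sum>i\<le>CARD('n). c i *s f i) = 0"
  \<comment> \<open>Linear dependence is a property of sets and does not see repetitions. If two
    iterates coincide, the relation is their difference, with coefficients 1 and -1.\<close>
  proof (cases "inj_on f {..CARD('n)}")
    case True
    have "vec.dependent (f ` {..CARD('n)})"
      using vec.independent_card_le_dim[of "f ` {..CARD('n)}" UNIV] card_image[OF True]
      by (auto simp del: vec.dim_UNIV simp: vec.dim_UNIV[unfolded card_cart_basis])
    then obtain u where u: "\<exists>w\<in>f ` {..CARD('n)}. u w \<noteq> 0" "(\<Sum>w\<in>f ` {..CARD('n)}. u w *s w) = 0"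
      using vec.dependent_finite[of "f ` {..CARD('n)}"] by auto
    then show ?thesis
      by (intro exI[of _ "u \<circ> f"]) (auto simp: sum.reindex[OF True])
  next
    case False
    then obtain i j where ij: "i \<le> CARD('n)" "j \<le> CARD('n)" "i \<noteq> j" "f i = f j"
      by (auto simp: inj_on_def)
    define c :: "nat \<Rightarrow> complex" where "c l = (if l = i then 1 else 0) - (if l = j then 1 else 0)" for l
    have "(\<Sum>l\<le>CARD('n). c l *s f l)
        = (\<Sum>l\<le>CARD('n). (if l = i then f l else 0)) - (\<Sum>l\<le>CARD('n). (if l = j then f l else 0))"
      unfolding sum_subtractf[symmetric] by (rule sum.cong) (auto simp: c_def)
    also have "\<dots> = 0" using ij by simp
    finally show ?thesis using ij by (intro exI[of _ c]) (auto simp: c_def)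
  qed
  then obtain c i where c: "i \<le> CARD('n)" "c i \<noteq> 0" "(\<Sum>i\<le>CARD('n). c i *s f i) = 0" by blast
  define p where "p = (\<Sum>i\<le>CARD('n). monom (c i) i)"
  have co: "coeff p l = (if l \<le> CARD('n) then c l else 0)" for l
    by (simp add: p_def coeff_sum if_distrib cong: if_cong)
  then have "degree p \<le> CARD('n)" by (intro degree_le) auto
  then have "poly_matrix_apply p Q v = (\<Sum>i\<le>CARD('n). c i *s f i)"
    by (subst poly_matrix_apply_altdef) (auto simp: co f_def)
  moreover have "p \<noteq> 0" using co[of i] c by auto
  ultimately show ?thesis using c by auto
qed

text \<open>
  The spectral radius is a supremum over eigenvalues, hence can only be estimated once an
  eigenvalue is known to exist.
\<close>

lemma eigenvalue_exists:
  fixes Q :: "complex ^ 'n ^ 'n"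
  shows "\<exists>\<mu> w. w \<noteq> 0 \<and> Q *v w = \<mu> *s w"
proof -
  obtain p where "p \<noteq> 0" "poly_matrix_apply p Q 1 = 0" using annihilating_poly_exists by metis
  moreover have "(1 :: complex ^ 'n) \<noteq> 0" by (simp add: vec_eq_iff)
  ultimately show ?thesis by (intro eigenvalue_if_annihilated)
qed

section \<open>Synthesis operators\<close>

lemma synthesis_add: "synthesis b (u + w) = synthesis b u + synthesis b w"
  by (simp add: synthesis_def scaleC_add_left sum.distrib)

lemma synthesis_scale: "synthesis b (\<mu> *s u) = \<mu> *\<^sub>C synthesis b u"
  by (simp add: synthesis_def scaleC_scaleC complex_vector.scale_sum_right)

lemma linear_synthesis: "linear (synthesis b)"
proof (rule linearI)
  show "synthesis b (r *\<^sub>R u) = r *\<^sub>R synthesis b u" for r u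
    by (simp add: synthesis_def scaleR_scaleC scaleR_conv_of_real[where 'a = complex] scaleC_scaleC
        complex_vector.scale_sum_right)
qed (rule synthesis_add)

lemma bounded_linear_synthesis: "bounded_linear (synthesis b)"
  using linear_synthesis linear_conv_bounded_linear by blast

lemma synthesis_0 [simp]: "synthesis b 0 = 0"
  by (simp add: synthesis_def)

lemma bij_betw_synthesis:
  assumes "is_basis b U"
  shows "bij_betw (synthesis b) UNIV U"
proof -
  have inj: "inj b" and indep: "complex_vector.independent (range b)"
    and span: "complex_vector.span (range b) = U"
    using assms by (auto simp: is_basis_def)
  \<comment> \<open>Rewriting the indexed sum over the set of basis vectors makes set-based
    independence and span applicable.\<close>
  have syn: "synthesis b u = (\<Sum>x\<in>range b. (u $ inv b x) *\<^sub>C x)" for u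
    by (simp add: sum.reindex[OF inj] synthesis_def inj)
  have "inj (synthesis b)"
  proof (rule linear_injective_0[OF linear_synthesis, THEN iffD2], intro allI impI)
    fix u assume "synthesis b u = 0"
    then have "u $ inv b x = 0" if "x \<in> range b" for x
      using complex_vector.independentD[OF indep, of "range b" "\<lambda>x. u $ inv b x" x] that
      by (auto simp: syn)
    then have "u $ inv b (b i) = 0" for i by blast
    then show "u = 0" by (simp add: vec_eq_iff inj)
  qed
  moreover have "range (synthesis b) = U"
  proof (intro equalityI subsetI)
    fix x assume "x \<in> U"
    then obtain g where "x = (\<Sum>y\<in>range b. g y *\<^sub>C y)"
      unfolding span[symmetric] by (auto simp: complex_vector.span_finite)
    then have "x = synthesis b (\<chi> i. g (b i))"
      by (simp add: synthesis_def sum.reindex[OF inj])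
    then show "x \<in> range (synthesis b)" by blast
  next
    fix x assume "x \<in> range (synthesis b)"
    then obtain u where "x = synthesis b u" by blast
    then show "x \<in> U"
      unfolding span[symmetric] synthesis_def
      by (auto intro: complex_vector.span_sum complex_vector.span_scale complex_vector.span_base)
  qed
  ultimately show ?thesis by (simp add: bij_betw_def)
qed

lemma synthesis_in: "is_basis b U \<Longrightarrow> synthesis b u \<in> U"
  using bij_betw_synthesis by (auto simp: bij_betw_def)

lemma synthesis_eq_iff: "is_basis b U \<Longrightarrow> synthesis b u = synthesis b w \<longleftrightarrow> u = w"
  using bij_betw_synthesis by (metis bij_betw_imp_inj_on inj_eq)

lemma synthesis_eq_0_iff: "is_basis b U \<Longrightarrow> synthesis b u = 0 \<longleftrightarrow> u = 0"
  using synthesis_eq_iff[of b U u 0] by simp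

lemma synthesis_cases:
  assumes "is_basis b U" "x \<in> U"
  obtains u where "x = synthesis b u"
  using assms bij_betw_synthesis by (fastforce simp: bij_betw_def)

lemma basis_nontrivial:
  assumes "is_basis b U"
  shows "\<exists>x\<in>U. x \<noteq> 0"
  using synthesis_in[OF assms, of 1] synthesis_eq_0_iff[OF assms, of 1]
  by (auto simp: vec_eq_iff)

lemma synthesis_coeffs:
  assumes "is_basis b U"
  shows "{u. synthesis b u \<in> U - {0}} = - {0}"
  using assms by (auto simp: synthesis_in synthesis_eq_0_iff)

lemma norm_synthesis_le:
  assumes "is_basis b U"
  shows "norm (synthesis b u) \<le> synthesis_norm b U * norm u"
proof (cases "u = 0")
  case False
  obtain K where K: "\<And>u. norm (synthesis b u) \<le> norm u * K"
    using bounded_linear.bounded[OF bounded_linear_synthesis] by blast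
  then have "bdd_above ((\<lambda>u. norm (synthesis b u) / norm u) ` (- {0}))"
    by (intro bdd_aboveI2[of _ _ K]) (simp add: divide_le_eq mult.commute)
  then have "norm (synthesis b u) / norm u \<le> synthesis_norm b U"
    unfolding synthesis_norm_def synthesis_coeffs[OF assms] using False by (intro cSUP_upper) auto
  then show ?thesis using False by (simp add: divide_le_eq)
qed simp

lemma synthesis_lower_le:
  assumes "is_basis b U"
  shows "synthesis_lower b U * norm u \<le> norm (synthesis b u)"
proof (cases "u = 0")
  case False
  have "synthesis_lower b U \<le> norm (synthesis b u) / norm u"
    unfolding synthesis_lower_def synthesis_coeffs[OF assms] using False
    by (intro cINF_lower bdd_belowI2[of _ 0]) auto
  then show ?thesis using False by (simp add: le_divide_eq)
qed simp

text \<open>By compactness the norm of the synthesised vector attains its minimum on the unit sphere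
  of coefficients. Injectivity makes this minimum positive, and homogeneity carries it to all
  nonzero coefficient vectors.\<close>

lemma synthesis_lower_pos:
  fixes b :: "'n :: finite \<Rightarrow> 'a :: complex_normed_vector"
  assumes "is_basis b U"
  shows "synthesis_lower b U > 0"
proof -
  obtain e :: "complex ^ 'n" where "norm e = 1" using vector_choose_size[of 1] by auto
  then have "sphere (0 :: complex ^ 'n) 1 \<noteq> {}" by auto
  then have "\<exists>w\<in>sphere 0 1. \<forall>u\<in>sphere 0 1. norm (synthesis b w) \<le> norm (synthesis b u)"
    by (intro continuous_attains_inf compact_sphere continuous_on_norm
        linear_continuous_on bounded_linear_synthesis)
  then obtain w where w: "norm w = 1"
    and min: "\<And>u. norm u = 1 \<Longrightarrow> norm (synthesis b w) \<le> norm (synthesis b u)"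
    by auto
  have "norm (synthesis b w) \<le> norm (synthesis b u) / norm u" if "u \<noteq> 0" for u
    using min[of "u /\<^sub>R norm u"] that linear_scale[OF linear_synthesis, of b "inverse (norm u)" u]
    by (simp add: divide_inverse_commute)
  moreover have "(1 :: complex ^ 'n) \<in> - {0}" by (simp add: vec_eq_iff)
  ultimately have "norm (synthesis b w) \<le> synthesis_lower b U"
    unfolding synthesis_lower_def synthesis_coeffs[OF assms] by (intro cINF_greatest) blast+
  moreover have "w \<noteq> 0" using w by auto
  then have "synthesis b w \<noteq> 0" by (simp add: synthesis_eq_0_iff[OF assms])
  then have "0 < norm (synthesis b w)" by simp
  ultimately show ?thesis by linarith
qed

section \<open>Condition numbers of an operator and of its matrix\<close>

text \<open>The constant \<open>K\<close> guarantees that the quotients are bounded above, so that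
  the real supremum really is an upper bound.\<close>

lemma norm_le_op_norm_on:
  assumes "\<And>x. x \<in> U \<Longrightarrow> norm (T x) \<le> K * norm x" "x \<in> U"
  shows "norm (T x) \<le> op_norm_on U T * norm x"
proof (cases "x = 0")
  case False
  have "bdd_above ((\<lambda>x. norm (T x) / norm x) ` (U - {0}))"
    using assms(1) by (intro bdd_aboveI2[of _ _ K]) (simp add: divide_le_eq)
  then have "norm (T x) / norm x \<le> op_norm_on U T"
    unfolding op_norm_on_def using False assms(2) by (intro cSUP_upper) auto
  then show ?thesis using False by (simp add: divide_le_eq)
qed (use assms(1)[OF assms(2)] in simp)

lemma op_norm_on_le:
  assumes "\<And>x. x \<in> U \<Longrightarrow> norm (T x) \<le> K * norm x" "\<exists>x\<in>U. x \<noteq> 0"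
  shows "op_norm_on U T \<le> K"
  unfolding op_norm_on_def using assms by (intro cSUP_least) (auto simp: divide_le_eq)

lemma op_norm_on_nonneg:
  assumes "\<And>x. x \<in> U \<Longrightarrow> norm (T x) \<le> K * norm x" "\<exists>x\<in>U. x \<noteq> 0"
  shows "0 \<le> op_norm_on U T"
proof -
  obtain x where "x \<in> U" "x \<noteq> 0" using assms by blast
  then have "0 \<le> op_norm_on U T * norm x"
    using norm_le_op_norm_on[of U T K x] assms(1) by (meson norm_ge_zero order_trans)
  then show ?thesis using \<open>x \<noteq> 0\<close> by (simp add: zero_le_mult_iff)
qed

lemma spectral_radius_bounds:
  assumes b: "is_basis b U"
    and T: "\<And>u. T (synthesis b u) = synthesis b (Q *v u)"
    and K: "\<And>x. x \<in> U \<Longrightarrow> norm (T x) \<le> K * norm x"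
  shows "0 \<le> spectral_radius Q" "spectral_radius Q \<le> op_norm_on U T"
proof -
  let ?S = "{\<mu>. \<exists>v. v \<noteq> 0 \<and> Q *v v = \<mu> *s v}"
  have le: "cmod \<mu> \<le> op_norm_on U T" if "\<mu> \<in> ?S" for \<mu>
  proof -
    obtain v where v: "v \<noteq> 0" "Q *v v = \<mu> *s v" using \<open>\<mu> \<in> ?S\<close> by blast
    have "cmod \<mu> * norm (synthesis b v) = norm (T (synthesis b v))"
      by (simp add: T v synthesis_scale norm_scaleC)
    also have "\<dots> \<le> op_norm_on U T * norm (synthesis b v)"
      using norm_le_op_norm_on[OF K synthesis_in[OF b]] .
    finally show ?thesis using v synthesis_eq_0_iff[OF b] by simp
  qed
  obtain \<mu> where \<mu>: "\<mu> \<in> ?S" using eigenvalue_exists[of Q] by blast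
  show "spectral_radius Q \<le> op_norm_on U T"
    unfolding spectral_radius_def using \<mu> le by (intro cSUP_least) auto
  \<comment> \<open>The eigenvalue found above lies below the supremum, which makes the latter
    nonnegative; this sign is used when two such bounds are multiplied.\<close>
  have "cmod \<mu> \<le> spectral_radius Q"
    unfolding spectral_radius_def using le by (intro cSUP_upper[OF \<mu>] bdd_aboveI2)
  then show "0 \<le> spectral_radius Q" by (rule order_trans[OF norm_ge_zero])
qed

text \<open>\<open>Q\<close> acts as \<open>T\<close> between two changes of norm: passing from
  coefficients to \<open>U\<close> costs \<open>synthesis_norm\<close>, and returning costs division
  by \<open>synthesis_lower\<close>.\<close>

lemma onorm_matrix_le:
  assumes b: "is_basis b U"
    and T: "\<And>u. T (synthesis b u) = synthesis b (Q *v u)"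
    and K: "\<And>x. x \<in> U \<Longrightarrow> norm (T x) \<le> K * norm x"
  shows "onorm ((*v) Q) \<le> op_norm_on U T * (synthesis_norm b U / synthesis_lower b U)"
proof (rule onorm_le)
  fix u
  have "synthesis_lower b U * norm (Q *v u) \<le> norm (T (synthesis b u))"
    using synthesis_lower_le[OF b] by (simp add: T)
  also have "\<dots> \<le> op_norm_on U T * norm (synthesis b u)"
    using norm_le_op_norm_on[OF K synthesis_in[OF b]] .
  also have "\<dots> \<le> op_norm_on U T * (synthesis_norm b U * norm u)"
    by (intro mult_left_mono norm_synthesis_le[OF b] op_norm_on_nonneg[OF K basis_nontrivial[OF b]])
  finally show "norm (Q *v u) \<le> op_norm_on U T * (synthesis_norm b U / synthesis_lower b U) * norm u"
    using synthesis_lower_pos[OF b] by (simp add: field_simps)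
qed

lemma
  assumes "invertible Q"
  shows matrix_inv_right: "Q ** matrix_inv Q = mat 1"
    and matrix_inv_left: "matrix_inv Q ** Q = mat 1"
proof -
  have "Q ** matrix_inv Q = mat 1 \<and> matrix_inv Q ** Q = mat 1"
    using assms unfolding invertible_def matrix_inv_def by (rule someI_ex)
  then show "Q ** matrix_inv Q = mat 1" "matrix_inv Q ** Q = mat 1" by auto
qed

lemma invertible_matrix_inv: "invertible Q \<Longrightarrow> invertible (matrix_inv Q)"
  using matrix_inv_left matrix_inv_right unfolding invertible_def by blast

text \<open>With this, the estimates for the pair \<open>T\<close>, \<open>Q\<close> apply verbatim
  to the pair of inverses.\<close>

lemma inverse_transports_to_matrix_inv:
  assumes b: "is_basis b U" and bij: "bij_betw T U U" and Q: "invertible Q"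
    and T: "\<And>u. T (synthesis b u) = synthesis b (Q *v u)"
  shows "inv_into U T (synthesis b u) = synthesis b (matrix_inv Q *v u)"
proof -
  have "T (synthesis b (matrix_inv Q *v u)) = synthesis b u"
    by (simp add: T matrix_vector_mul_assoc matrix_inv_right[OF Q])
  then show ?thesis
    using inv_into_f_f[OF bij_betw_imp_inj_on[OF bij] synthesis_in[OF b]] by metis
qed

lemma condition_numbers_le:
  assumes b: "is_basis b U" and bij: "bij_betw T U U" and Q: "invertible Q"
    and T: "\<And>u. T (synthesis b u) = synthesis b (Q *v u)"
    and K: "\<And>x. x \<in> U \<Longrightarrow> norm (T x) \<le> K * norm x"
    and L: "\<And>x. x \<in> U \<Longrightarrow> norm x \<le> L * norm (T x)"
  shows "cond_spectral Q \<le> cond_op U T" "cond_op U T \<le> K * L"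
    "cond_2 Q \<le> cond_op U T * (synthesis_norm b U / synthesis_lower b U)\<^sup>2"
proof -
  let ?T' = "inv_into U T" and ?K = "synthesis_norm b U / synthesis_lower b U"
  have T': "?T' (synthesis b u) = synthesis b (matrix_inv Q *v u)" for u
    using inverse_transports_to_matrix_inv[OF b bij Q T] .
  \<comment> \<open>The lower bound for \<open>T\<close>, taken at the preimage of \<open>x\<close>,
    is an upper bound for the inverse.\<close>
  have L': "norm (?T' x) \<le> L * norm x" if "x \<in> U" for x
    using L[of "?T' x"] that bij inv_into_into[of x T U] f_inv_into_f[of x T U]
    by (auto simp: bij_betw_def)
  note nt = basis_nontrivial[OF b]
  note nonneg = op_norm_on_nonneg[OF K nt] op_norm_on_nonneg[OF L' nt]
  show "cond_spectral Q \<le> cond_op U T"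
    unfolding cond_spectral_def cond_op_def
    using spectral_radius_bounds[OF b T K] spectral_radius_bounds[OF b T' L'] nonneg
    by (intro mult_mono) auto
  have "op_norm_on U T \<le> K" "op_norm_on U ?T' \<le> L"
    using op_norm_on_le[OF K nt] op_norm_on_le[OF L' nt] by auto
  then show "cond_op U T \<le> K * L"
    unfolding cond_op_def using nonneg by (intro mult_mono) auto
  have "0 \<le> onorm ((*v) Q)" "0 \<le> onorm ((*v) (matrix_inv Q))"
    by (intro onorm_pos_le matrix_vector_mul_bounded_linear)+
  then have "cond_2 Q \<le> (op_norm_on U T * ?K) * (op_norm_on U ?T' * ?K)"
    unfolding cond_2_def
    using onorm_matrix_le[OF b T K] onorm_matrix_le[OF b T' L'] by (intro mult_mono) auto
  then show "cond_2 Q \<le> cond_op U T * ?K\<^sup>2"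
    by (simp only: cond_op_def power2_eq_square mult_ac)
qed

section \<open>Forms, discrete operators and Galerkin matrices\<close>

lemma cmod_le_form_norm:
  assumes "bounded_sesquilinear s"
  shows "cmod (s x y) \<le> form_norm s * norm x * norm y"
proof -
  interpret bounded_bilinear s using assms by (simp add: bounded_sesquilinear_def)
  obtain K where K: "\<And>x y. cmod (s x y) \<le> norm x * norm y * K" using bounded by blast
  show ?thesis
  proof (cases "x = 0 \<or> y = 0")
    case True
    \<comment> \<open>Both sides vanish, whatever the value of the supremum.\<close>
    then show ?thesis by (auto simp: zero_left zero_right)
  next
    case False
    have "cmod (s x y) / (norm x * norm y) \<le> K" if "x \<noteq> 0" "y \<noteq> 0" for x y
      using K[of x y] that by (simp add: pos_divide_le_eq mult.commute)
    then have "bdd_above ((\<lambda>(x, y). cmod (s x y) / (norm x * norm y)) ` ((UNIV - {0}) \<times> (UNIV - {0})))"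
      by (intro bdd_aboveI2[of _ _ K]) auto
    with False have "(\<lambda>(x, y). cmod (s x y) / (norm x * norm y)) (x, y) \<le> form_norm s"
      unfolding form_norm_def by (intro cSUP_upper) auto
    then show ?thesis using False by (simp add: divide_le_eq mult_ac)
  qed
qed

text \<open>Every bound on the functional \<open>t u\<close> over \<open>Z\<close> dominates the
  supremum in the inf-sup condition. A nonzero element of \<open>Z\<close> keeps this supremum from
  ranging over the empty set.\<close>

lemma inf_sup_le:
  assumes "discrete_inf_sup t U Z \<gamma>" "u \<in> U" "\<exists>y\<in>Z. y \<noteq> 0"
    and "\<And>y. y \<in> Z \<Longrightarrow> cmod (t u y) \<le> B * norm y"
  shows "\<gamma> * norm u \<le> B"
proof -
  have "\<gamma> * norm u \<le> (SUP v\<in>Z - {0}. cmod (t u v) / norm v)"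
    using assms by (simp add: discrete_inf_sup_def)
  also have "\<dots> \<le> B"
    using assms by (intro cSUP_least) (auto simp: divide_le_eq)
  finally show ?thesis .
qed

lemma inf_sup_compare:
  assumes "bounded_sesquilinear s" "discrete_inf_sup t U Z \<gamma>" "u \<in> U" "\<exists>y\<in>Z. y \<noteq> 0"
    and "\<And>y. y \<in> Z \<Longrightarrow> s x y = t u y"
  shows "\<gamma> * norm u \<le> form_norm s * norm x"
  using inf_sup_le[OF assms(2-4), of "form_norm s * norm x"] cmod_le_form_norm[OF assms(1), of x] assms(5)
  by metis

text \<open>The two nonzero vectors show that the supremum defining \<open>form_norm\<close> is not
  over the empty set.\<close>

lemma form_norm_nonneg:
  fixes x :: "'a :: complex_normed_vector" and y :: "'b :: complex_normed_vector"
  assumes "bounded_sesquilinear (s :: 'a \<Rightarrow> 'b \<Rightarrow> complex)" "x \<noteq> 0" "y \<noteq> 0"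
  shows "0 \<le> form_norm s"
proof -
  have "0 \<le> form_norm s * (norm x * norm y)"
    using cmod_le_form_norm[OF assms(1), of x y] by (metis norm_ge_zero order_trans mult.assoc)
  moreover have "0 < norm x * norm y" using assms by simp
  ultimately show ?thesis by (simp only: zero_le_mult_iff) linarith
qed

text \<open>Stated for a general functional because it serves twice: for a form in its second
  argument, and for an arbitrary element of \<open>antidual Z\<close> in the surjectivity
  proof.\<close>

lemma antilinear_synthesis:
  assumes d: "is_basis d Z"
    and add: "\<forall>x\<in>Z. \<forall>y\<in>Z. f (x + y) = f x + f y"
    and scale: "\<forall>c. \<forall>x\<in>Z. f (c *\<^sub>C x) = cnj c * f x"
  shows "f (synthesis d w) = (\<Sum>i\<in>UNIV. cnj (w $ i) * f (d i))"
proof -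
  have Z: "Z = complex_vector.span (range d)" using d by (simp add: is_basis_def)
  have di: "d i \<in> Z" for i by (auto simp: Z intro: complex_vector.span_base)
  have 0: "f 0 = 0" using scale di[of undefined] complex_vector.scale_zero_left by (metis complex_cnj_zero mult_zero_left)
  \<comment> \<open>Membership in \<open>Z\<close> is carried through the induction because
    \<open>f\<close> is additive only there.\<close>
  have "(\<Sum>i\<in>I. (w $ i) *\<^sub>C d i) \<in> Z \<and> f (\<Sum>i\<in>I. (w $ i) *\<^sub>C d i) = (\<Sum>i\<in>I. cnj (w $ i) * f (d i))"
    if "finite I" for I
    using that
  proof induction
    case empty
    then show ?case by (simp add: 0 Z complex_vector.span_zero)
  next
    case (insert j I)
    have "(w $ j) *\<^sub>C d j \<in> Z" using di by (auto simp: Z intro: complex_vector.span_scale)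
    with insert show ?case
      using add scale di by (auto simp: Z intro: complex_vector.span_add)
  qed
  from this[of UNIV] show ?thesis by (simp add: synthesis_def)
qed

lemma galerkin_matrix_mult:
  assumes "bounded_sesquilinear s"
  shows "(galerkin_matrix s b d *v u) $ i = s (synthesis b u) (d i)"
proof -
  interpret bounded_bilinear s using assms by (simp add: bounded_sesquilinear_def)
  show ?thesis using assms
    by (simp add: galerkin_matrix_def matrix_vector_mult_def synthesis_def sum_left
        bounded_sesquilinear_def mult.commute)
qed

text \<open>The form becomes the Euclidean pairing of \<open>w\<close> with the Galerkin matrix
  applied to \<open>u\<close>. Hence the image vector alone determines the functional on
  \<open>Z\<close>, which is what lets matrices stand in for discrete operators.\<close>

lemma galerkin_pairing:
  assumes s: "bounded_sesquilinear s" and d: "is_basis d Z"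
  shows "s (synthesis b u) (synthesis d w) = (\<Sum>i\<in>UNIV. cnj (w $ i) * (galerkin_matrix s b d *v u) $ i)"
proof -
  interpret bounded_bilinear s using s by (simp add: bounded_sesquilinear_def)
  show ?thesis
    unfolding galerkin_matrix_mult[OF s]
    using s by (intro antilinear_synthesis[OF d]) (auto simp: add_right bounded_sesquilinear_def)
qed

lemma discrete_op_eqI:
  assumes s: "bounded_sesquilinear s" and t: "bounded_sesquilinear t"
    and b: "is_basis b U" and b': "is_basis b' U'" and d: "is_basis d Z"
    and "galerkin_matrix s b d *v u = galerkin_matrix t b' d *v u'"
  shows "discrete_op s U Z (synthesis b u) = discrete_op t U' Z (synthesis b' u')"
proof -
  have "s (synthesis b u) y = t (synthesis b' u') y" if "y \<in> Z" for y
    using synthesis_cases[OF d that] assms(6) by (metis galerkin_pairing[OF s d] galerkin_pairing[OF t d])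
  then show ?thesis
    by (simp add: discrete_op_def synthesis_in[OF b] synthesis_in[OF b'] cong: restrict_cong)
qed

section \<open>Unique solvability of the discrete problems\<close>

lemma inf_sup_eq_0:
  assumes "discrete_inf_sup t U Z \<gamma>" "\<gamma> > 0" "u \<in> U" "\<exists>y\<in>Z. y \<noteq> 0" "\<And>y. y \<in> Z \<Longrightarrow> t u y = 0"
  shows "u = 0"
  using inf_sup_le[OF assms(1,3,4), of 0] assms(2,5) by (simp add: mult_le_0_iff)

text \<open>A kernel vector synthesises to an element on which the form vanishes against all of
  \<open>Z\<close>, so the inf-sup condition forces it to be 0. The matrix is square, hence a
  trivial kernel suffices.\<close>

lemma invertible_galerkin_matrix:
  assumes s: "bounded_sesquilinear s" and b: "is_basis b U" and d: "is_basis d Z"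
    and "discrete_inf_sup s U Z \<gamma>" "\<gamma> > 0"
  shows "invertible (galerkin_matrix s b d)"
proof -
  have "u = 0" if "galerkin_matrix s b d *v u = 0" for u
  proof -
    have "s (synthesis b u) y = 0" if "y \<in> Z" for y
      using \<open>y \<in> Z\<close> \<open>galerkin_matrix s b d *v u = 0\<close>
      by (auto simp: galerkin_pairing[OF s d] elim!: synthesis_cases[OF d])
    then show ?thesis
      using inf_sup_eq_0[OF assms(4,5) synthesis_in[OF b] basis_nontrivial[OF d]]
        synthesis_eq_0_iff[OF b] by blast
  qed
  then show ?thesis
    using matrix_left_invertible_ker[of "galerkin_matrix s b d"] invertible_left_inverse by blast
qed

text \<open>Injectivity is the inf-sup condition applied to a difference. Surjectivity amounts to
  solving the Galerkin system whose right-hand side lists the values of the functional on the test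
  basis.\<close>

lemma bij_betw_discrete_op:
  fixes b :: "'n :: finite \<Rightarrow> 'a :: complex_normed_vector"
    and d :: "'n \<Rightarrow> 'b :: complex_normed_vector"
  assumes s: "bounded_sesquilinear s" and b: "is_basis b U" and d: "is_basis d Z"
    and infsup: "discrete_inf_sup s U Z \<gamma>" "\<gamma> > 0"
  shows "bij_betw (discrete_op s U Z) U (antidual Z)"
proof -
  interpret bounded_bilinear s using s by (simp add: bounded_sesquilinear_def)
  have subspace: "complex_vector.subspace U" "complex_vector.subspace Z"
    using b d by (auto simp: is_basis_def complex_vector.subspace_span)
  have "inj_on (discrete_op s U Z) U"
  proof (rule inj_onI)
    fix x y assume xy: "x \<in> U" "y \<in> U" "discrete_op s U Z x = discrete_op s U Z y"
    have "s x z = s y z" if "z \<in> Z" for z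
      using fun_cong[OF xy(3), of z] xy that by (simp add: discrete_op_def)
    then have "x - y = 0"
      using xy subspace
      by (intro inf_sup_eq_0[OF infsup _ basis_nontrivial[OF d]])
        (auto simp: diff_left intro: complex_vector.subspace_diff)
    then show "x = y" by simp
  qed
  moreover have "discrete_op s U Z x \<in> antidual Z" if "x \<in> U" for x
    using that s cmod_le_form_norm[OF s, of x] subspace
    by (auto simp: antidual_def discrete_op_def add_right bounded_sesquilinear_def
        complex_vector.subspace_add complex_vector.subspace_scale intro!: exI[of _ "form_norm s * norm x"])
  moreover have "f \<in> discrete_op s U Z ` U" if f: "f \<in> antidual Z" for f
  proof -
    let ?G = "galerkin_matrix s b d" and ?r = "\<chi> i. f (d i)"
    have inv: "invertible ?G" using invertible_galerkin_matrix[OF s b d infsup] .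
    define u where "u = matrix_inv ?G *v ?r"
    have Gu: "?G *v u = ?r"
      by (simp add: u_def matrix_vector_mul_assoc matrix_inv_right[OF inv])
    have "f (synthesis d w) = s (synthesis b u) (synthesis d w)" for w
      using antilinear_synthesis[OF d, of f w] f
      by (simp add: galerkin_pairing[OF s d] Gu antidual_def)
    then have "f y = s (synthesis b u) y" if "y \<in> Z" for y
      using that by (metis synthesis_cases[OF d])
    \<comment> \<open>Elements of \<open>antidual Z\<close> are extensional, so agreement on
      \<open>Z\<close> becomes equality of functions.\<close>
    moreover have "f y = undefined" if "y \<notin> Z" for y
      using that f by (auto simp: antidual_def extensional_def)
    ultimately have "f = discrete_op s U Z (synthesis b u)"
      by (auto simp: fun_eq_iff discrete_op_def synthesis_in[OF b])
    then show ?thesis using synthesis_in[OF b] by blast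
  qed
  ultimately show ?thesis by (auto simp: bij_betw_def)
qed

text \<open>The vector \<open>?w\<close> solves the Galerkin system of \<open>t\<close> with the
  data of \<open>s\<close>; both synthesised elements therefore induce the same functional on
  \<open>Z\<close>, and injectivity identifies the preimage.\<close>

lemma inv_into_discrete_op_synthesis:
  fixes b :: "'n :: finite \<Rightarrow> 'a :: complex_normed_vector"
    and b' :: "'n \<Rightarrow> 'b :: complex_normed_vector"
    and d :: "'n \<Rightarrow> 'c :: complex_normed_vector"
  assumes s: "bounded_sesquilinear s" and t: "bounded_sesquilinear t"
    and b: "is_basis b U" and b': "is_basis b' U'" and d: "is_basis d Z"
    and infsup: "discrete_inf_sup t U' Z \<gamma>" "\<gamma> > 0"
  shows "inv_into U' (discrete_op t U' Z) (discrete_op s U Z (synthesis b u))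
    = synthesis b' (matrix_inv (galerkin_matrix t b' d) *v (galerkin_matrix s b d *v u))"
    (is "_ = synthesis b' ?w")
proof -
  have "discrete_op s U Z (synthesis b u) = discrete_op t U' Z (synthesis b' ?w)"
    using invertible_galerkin_matrix[OF t b' d infsup]
    by (intro discrete_op_eqI[OF s t b b' d])
      (simp add: matrix_vector_mul_assoc matrix_mul_assoc matrix_inv_right)
  then show ?thesis
    using inv_into_f_f[OF bij_betw_imp_inj_on[OF bij_betw_discrete_op[OF t b' d infsup]] synthesis_in[OF b']]
    by metis
qed

text \<open>\<open>x'\<close> is the Galerkin solution of \<open>t x' y = s x y\<close> for all
  \<open>y\<close> in \<open>Z\<close>. Since this relation is symmetric in the two forms, the
  inf-sup condition of either one yields one of the two estimates.\<close>

lemma inv_into_discrete_op: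
  fixes b :: "'n :: finite \<Rightarrow> 'a :: complex_normed_vector"
    and b' :: "'n \<Rightarrow> 'b :: complex_normed_vector"
    and d :: "'n \<Rightarrow> 'c :: complex_normed_vector"
  assumes "bounded_sesquilinear s" "bounded_sesquilinear t"
    and "is_basis b U" "is_basis b' U'" "is_basis d Z"
    and "discrete_inf_sup s U Z \<gamma>" "\<gamma> > 0" "discrete_inf_sup t U' Z \<gamma>'" "\<gamma>' > 0" "x \<in> U"
    and x'_def: "x' = inv_into U' (discrete_op t U' Z) (discrete_op s U Z x)"
  shows "x' \<in> U'"
    and "\<gamma>' * norm x' \<le> form_norm s * norm x"
    and "\<gamma> * norm x \<le> form_norm t * norm x'"
proof -
  note s = bij_betw_discrete_op[OF assms(1,3,5,6,7)] and t = bij_betw_discrete_op[OF assms(2,4,5,8,9)]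
  have "discrete_op s U Z x \<in> discrete_op t U' Z ` U'"
    using s t assms(10) by (auto simp: bij_betw_def)
  then have x': "x' \<in> U'" and "discrete_op t U' Z x' = discrete_op s U Z x"
    unfolding x'_def by (auto intro: inv_into_into f_inv_into_f)
  then have "s x y = t x' y" if "y \<in> Z" for y
    using that x' assms(10) fun_cong[of "discrete_op t U' Z x'" "discrete_op s U Z x" y]
    by (simp add: discrete_op_def del: restrict_apply) (metis restrict_apply')
  then show "x' \<in> U'" "\<gamma>' * norm x' \<le> form_norm s * norm x" "\<gamma> * norm x \<le> form_norm t * norm x'"
    using inf_sup_compare[OF assms(1,8) x' basis_nontrivial[OF assms(5)], of x]
      inf_sup_compare[OF assms(2,6,10) basis_nontrivial[OF assms(5)], of x'] x' by simp_all
qed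

lemma bij_betw_inv_into_discrete_op:
  fixes b :: "'n :: finite \<Rightarrow> 'a :: complex_normed_vector"
    and b' :: "'n \<Rightarrow> 'b :: complex_normed_vector"
    and d :: "'n \<Rightarrow> 'c :: complex_normed_vector"
  assumes "bounded_sesquilinear s" "bounded_sesquilinear t"
    and "is_basis b U" "is_basis b' U'" "is_basis d Z"
    and "discrete_inf_sup s U Z \<gamma>" "\<gamma> > 0" "discrete_inf_sup t U' Z \<gamma>'" "\<gamma>' > 0"
  shows "bij_betw (inv_into U' (discrete_op t U' Z) \<circ> discrete_op s U Z) U U'"
  using bij_betw_discrete_op[OF assms(1,3,5,6,7)]
    bij_betw_inv_into[OF bij_betw_discrete_op[OF assms(2,4,5,8,9)]]
  by (rule bij_betw_trans)

section \<open>Condition numbers of the preconditioned operator and matrix\<close>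

theorem theorem1:
  fixes a :: "'x :: complex_banach \<Rightarrow> 'y :: complex_banach \<Rightarrow> complex"
    and c :: "'v :: complex_banach \<Rightarrow> 'w :: complex_banach \<Rightarrow> complex"
    and n :: "'v \<Rightarrow> 'y \<Rightarrow> complex"
    and m :: "'x \<Rightarrow> 'w \<Rightarrow> complex"
    and X\<^sub>h :: "'x set" and Y\<^sub>h :: "'y set" and V\<^sub>h :: "'v set" and W\<^sub>h :: "'w set"
    and \<gamma>\<^sub>A \<gamma>\<^sub>C \<gamma>\<^sub>N \<gamma>\<^sub>M :: real
    and \<phi>X :: "'N :: finite \<Rightarrow> 'x" and \<phi>Y :: "'N \<Rightarrow> 'y"
    and \<phi>V :: "'N \<Rightarrow> 'v" and \<phi>W :: "'N \<Rightarrow> 'w"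
  assumes "reflexive_space TYPE('x)" and "reflexive_space TYPE('y)"
    and "reflexive_space TYPE('v)" and "reflexive_space TYPE('w)"
    and "bounded_sesquilinear a" and "bounded_sesquilinear c"
    and "bounded_sesquilinear n" and "bounded_sesquilinear m"
    and "\<forall>b\<in>antidual UNIV. \<exists>!u. \<forall>v. a u v = b v"
    and "complex_vector.subspace X\<^sub>h" and "complex_vector.dim X\<^sub>h = CARD('N)"
    and "complex_vector.subspace Y\<^sub>h" and "complex_vector.dim Y\<^sub>h = CARD('N)"
    and "complex_vector.subspace V\<^sub>h" and "complex_vector.dim V\<^sub>h = CARD('N)"
    and "complex_vector.subspace W\<^sub>h" and "complex_vector.dim W\<^sub>h = CARD('N)"
    and "\<gamma>\<^sub>A > 0" and "discrete_inf_sup a X\<^sub>h Y\<^sub>h \<gamma>\<^sub>A"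
    and "\<gamma>\<^sub>C > 0" and "discrete_inf_sup c V\<^sub>h W\<^sub>h \<gamma>\<^sub>C"
    and "\<gamma>\<^sub>N > 0" and "discrete_inf_sup n V\<^sub>h Y\<^sub>h \<gamma>\<^sub>N"
    and "\<gamma>\<^sub>M > 0" and "discrete_inf_sup m X\<^sub>h W\<^sub>h \<gamma>\<^sub>M"
    and "is_basis \<phi>X X\<^sub>h" and "is_basis \<phi>Y Y\<^sub>h"
    and "is_basis \<phi>V V\<^sub>h" and "is_basis \<phi>W W\<^sub>h"
  shows "let
      A\<^sub>h = discrete_op a X\<^sub>h Y\<^sub>h;
      C\<^sub>h = discrete_op c V\<^sub>h W\<^sub>h;
      N\<^sub>h = discrete_op n V\<^sub>h Y\<^sub>h;
      M\<^sub>h = discrete_op m X\<^sub>h W\<^sub>h;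
      P\<^sub>h = inv_into X\<^sub>h M\<^sub>h \<circ> C\<^sub>h \<circ> inv_into V\<^sub>h N\<^sub>h;
      A = galerkin_matrix a \<phi>X \<phi>Y;
      C = galerkin_matrix c \<phi>V \<phi>W;
      N = galerkin_matrix n \<phi>V \<phi>Y;
      M = galerkin_matrix m \<phi>X \<phi>W;
      P = matrix_inv M ** C ** matrix_inv N;
      K_star = form_norm m * form_norm n * form_norm c * form_norm a / (\<gamma>\<^sub>M * \<gamma>\<^sub>N * \<gamma>\<^sub>C * \<gamma>\<^sub>A);
      K_Lambda = synthesis_norm \<phi>X X\<^sub>h / synthesis_lower \<phi>X X\<^sub>h
    in
      bij_betw M\<^sub>h X\<^sub>h (antidual W\<^sub>h) \<and> bij_betw N\<^sub>h V\<^sub>h (antidual Y\<^sub>h) \<and>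
      bij_betw (P\<^sub>h \<circ> A\<^sub>h) X\<^sub>h X\<^sub>h \<and>
      invertible M \<and> invertible N \<and> invertible (P ** A) \<and>
      cond_spectral (P ** A) \<le> cond_op X\<^sub>h (P\<^sub>h \<circ> A\<^sub>h) \<and>
      cond_op X\<^sub>h (P\<^sub>h \<circ> A\<^sub>h) \<le> K_star \<and>
      cond_2 (P ** A) \<le> K_star * K_Lambda\<^sup>2"
proof -
  note sesq = assms(5-8) and basis = assms(26-29)
  note pos = \<open>\<gamma>\<^sub>A > 0\<close> \<open>\<gamma>\<^sub>C > 0\<close> \<open>\<gamma>\<^sub>N > 0\<close> \<open>\<gamma>\<^sub>M > 0\<close>
  define A\<^sub>h C\<^sub>h N\<^sub>h M\<^sub>h where ops: "A\<^sub>h = discrete_op a X\<^sub>h Y\<^sub>h" "C\<^sub>h = discrete_op c V\<^sub>h W\<^sub>h"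
    "N\<^sub>h = discrete_op n V\<^sub>h Y\<^sub>h" "M\<^sub>h = discrete_op m X\<^sub>h W\<^sub>h"
  define A C N M where mats: "A = galerkin_matrix a \<phi>X \<phi>Y" "C = galerkin_matrix c \<phi>V \<phi>W"
    "N = galerkin_matrix n \<phi>V \<phi>Y" "M = galerkin_matrix m \<phi>X \<phi>W"
  \<comment> \<open>\<open>P\<^sub>h A\<^sub>h\<close> is split at \<open>V\<^sub>h\<close>:
    \<open>F\<close> maps \<open>X\<^sub>h\<close> to \<open>V\<^sub>h\<close> with common test
    space \<open>Y\<^sub>h\<close>, and \<open>G\<close> maps back with common test space
    \<open>W\<^sub>h\<close>. Each factor inverts one discrete operator after applying
    another.\<close>
  define F where "F = inv_into V\<^sub>h N\<^sub>h \<circ> A\<^sub>h"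
  define G where "G = inv_into X\<^sub>h M\<^sub>h \<circ> C\<^sub>h"
  define T where "T = (inv_into X\<^sub>h M\<^sub>h \<circ> C\<^sub>h \<circ> inv_into V\<^sub>h N\<^sub>h) \<circ> A\<^sub>h"
  define Q where "Q = (matrix_inv M ** C ** matrix_inv N) ** A"
  have T: "T x = G (F x)" for x by (simp add: T_def F_def G_def o_apply)
  \<comment> \<open>\<open>K\<close> will bound \<open>T\<close> and \<open>L\<close> its inverse;
    each is a product of one constant from \<open>F\<close> and one from \<open>G\<close>, and
    together they give \<open>K_star\<close>.\<close>
  define K where "K = form_norm c / \<gamma>\<^sub>M * (form_norm a / \<gamma>\<^sub>N)"
  define L where "L = form_norm n / \<gamma>\<^sub>A * (form_norm m / \<gamma>\<^sub>C)"
  have F: "F x \<in> V\<^sub>h" "norm (F x) \<le> form_norm a / \<gamma>\<^sub>N * norm x"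
    "norm x \<le> form_norm n / \<gamma>\<^sub>A * norm (F x)" if "x \<in> X\<^sub>h" for x
    using inv_into_discrete_op[OF sesq(1,3) basis(1,3,2) assms(19,18,23,22) that refl] pos
    by (simp_all add: F_def ops o_apply field_simps)
  have G: "G v \<in> X\<^sub>h" "norm (G v) \<le> form_norm c / \<gamma>\<^sub>M * norm v"
    "norm v \<le> form_norm m / \<gamma>\<^sub>C * norm (G v)" if "v \<in> V\<^sub>h" for v
    using inv_into_discrete_op[OF sesq(2,4) basis(3,1,4) assms(21,20,25,24) that refl] pos
    by (simp_all add: G_def ops o_apply field_simps)
  have nontrivial: "\<exists>x\<in>X\<^sub>h. x \<noteq> 0" "\<exists>y\<in>Y\<^sub>h. y \<noteq> 0" "\<exists>v\<in>V\<^sub>h. v \<noteq> 0" "\<exists>w\<in>W\<^sub>h. w \<noteq> 0"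
    using basis basis_nontrivial by blast+
  \<comment> \<open>These are the outer constants when the estimates are chained: \<open>c\<close>
    in front of the bound for \<open>F\<close>, and \<open>n\<close> in front of the inverse bound
    for \<open>G\<close>.\<close>
  then have nonneg: "form_norm c \<ge> 0" "form_norm n \<ge> 0"
    using form_norm_nonneg sesq by metis+
  have bound_T: "norm (T x) \<le> K * norm x" if "x \<in> X\<^sub>h" for x
  proof -
    have "norm (T x) \<le> form_norm c / \<gamma>\<^sub>M * norm (F x)" using G(2) F(1) that by (simp add: T)
    also have "\<dots> \<le> form_norm c / \<gamma>\<^sub>M * (form_norm a / \<gamma>\<^sub>N * norm x)"
      using F(2)[OF that] nonneg pos by (intro mult_left_mono) auto
    finally show ?thesis by (simp add: K_def)
  qed
  have bound_T_inv: "norm x \<le> L * norm (T x)" if "x \<in> X\<^sub>h" for x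
  proof -
    have "norm x \<le> form_norm n / \<gamma>\<^sub>A * norm (F x)" using F(3) that .
    also have "\<dots> \<le> form_norm n / \<gamma>\<^sub>A * (form_norm m / \<gamma>\<^sub>C * norm (T x))"
      using G(3)[OF F(1)[OF that]] nonneg pos by (intro mult_left_mono) (auto simp: T)
    finally show ?thesis by (simp add: L_def)
  qed
  have "bij_betw F X\<^sub>h V\<^sub>h" "bij_betw G V\<^sub>h X\<^sub>h"
    unfolding F_def G_def ops
    using bij_betw_inv_into_discrete_op[OF sesq(1,3) basis(1,3,2) assms(19,18,23,22)]
      bij_betw_inv_into_discrete_op[OF sesq(2,4) basis(3,1,4) assms(21,20,25,24)] by auto
  then have "bij_betw (G \<circ> F) X\<^sub>h X\<^sub>h" by (rule bij_betw_trans)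
  moreover have "G \<circ> F = T" by (simp add: fun_eq_iff T o_apply)
  ultimately have bij_T: "bij_betw T X\<^sub>h X\<^sub>h" by simp
  have T_synthesis: "T (synthesis \<phi>X u) = synthesis \<phi>X (Q *v u)" for u
  proof -
    have "F (synthesis \<phi>X u) = synthesis \<phi>V (matrix_inv N *v (A *v u))"
      unfolding F_def ops mats o_apply
      by (rule inv_into_discrete_op_synthesis[OF sesq(1,3) basis(1,3,2) assms(23,22)])
    moreover have "G (synthesis \<phi>V v) = synthesis \<phi>X (matrix_inv M *v (C *v v))" for v
      unfolding G_def ops mats o_apply
      by (rule inv_into_discrete_op_synthesis[OF sesq(2,4) basis(3,1,4) assms(25,24)])
    ultimately show ?thesis by (simp add: T Q_def matrix_vector_mul_assoc matrix_mul_assoc)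
  qed
  have inv: "invertible A" "invertible C" "invertible N" "invertible M"
    unfolding mats using invertible_galerkin_matrix sesq basis assms(18-25) by blast+
  then have inv_Q: "invertible Q"
    unfolding Q_def by (intro invertible_mult invertible_matrix_inv)
  note cond = condition_numbers_le[OF basis(1) bij_T inv_Q T_synthesis bound_T bound_T_inv]
  have KL: "K * L = form_norm m * form_norm n * form_norm c * form_norm a / (\<gamma>\<^sub>M * \<gamma>\<^sub>N * \<gamma>\<^sub>C * \<gamma>\<^sub>A)"
    by (simp add: K_def L_def mult_ac)
  \<comment> \<open>The Euclidean estimate is first relative to \<open>cond_op\<close>, which is
    then replaced by its bound \<open>K * L\<close>.\<close>
  have "cond_2 Q \<le> K * L * (synthesis_norm \<phi>X X\<^sub>h / synthesis_lower \<phi>X X\<^sub>h)\<^sup>2"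
    using cond(3) mult_right_mono[OF cond(2) zero_le_power2] by (rule order_trans)
  moreover have "bij_betw M\<^sub>h X\<^sub>h (antidual W\<^sub>h)" "bij_betw N\<^sub>h V\<^sub>h (antidual Y\<^sub>h)"
    unfolding ops using bij_betw_discrete_op sesq basis assms(22-25) by blast+
  ultimately show ?thesis
    using bij_T inv inv_Q cond(1,2) unfolding KL T_def Q_def ops mats Let_def by blast
qed

end
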